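(* Fix $m\in\mathbb{N}$ and $c\in[0,1]$ and let $\mu$ denote Lebesgue measure. Then there exist sequences $(A_i)_{i\in\mathbb{N}}$ and $(B_i)_{i\in\mathbb{N}}$ of Borel subsets of $[0,1]$ satisfying: (i) $\mu(A_i)=\mu(B_i)$ for all $i\in\mathbb{N}$; (ii) for any sequence of natural numbers $i_1,i_2,\dots,i_l$ with $1\le l\le m$, we have \[\mu(A_{i_1}\cap\dots\cap A_{i_l})=\mu(B_{i_1}\cap\dots\cap B_{i_l});\] (iii) $\mu(\limsup_{i\to\infty}A_i)=0$; and (iv) $\mu(\limsup_{i\to\infty}B_i)=c$.
   Context: $\mathbb{N}=\{1,2,3,\dots\}$. For a sequence of sets $(A_i)_{i\in\mathbb{N}}$, $\limsup_{i\to\infty}A_i=\bigcap_{n\ge1}\bigcup_{i\ge n}A_i$ is the set of points lying in $A_i$ for infinitely many $i$. *)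

theory Defs
  imports "HOL-Analysis.Analysis"
begin

end

theory Submission
  imports Defs "HOL-Library.Nat_Bijection"
begin

text \<open>
  The construction amplifies the classical parity example. Let \<open>S\<close> be a uniformly random
  subset of \<open>{0..m}\<close> of even size and \<open>S'\<close> one of odd size. For \<open>I\<close> with at most \<open>m\<close> elements,
  the events \<open>I \<subseteq> S\<close> and \<open>I \<subseteq> S'\<close> are equally likely: toggling a fixed element outside \<open>I\<close>
  exchanges the two families. Yet \<open>S'\<close> is never empty, whereas \<open>S\<close> is empty with positive
  probability.

  Repeating the experiment independently amplifies this difference. Given independent copies
  \<open>S\<^sub>0, S\<^sub>1, \<dots>\<close>, attach to each finite word \<open>w\<close> the event that \<open>w ! s \<in> S\<^sub>s\<close> for all positions
  \<open>s\<close> of \<open>w\<close>. An intersection of \<open>l \<le> m\<close> such events demands \<open>I\<^sub>s \<subseteq> S\<^sub>s\<close> for each \<open>s\<close>, where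
  \<open>I\<^sub>s\<close> has at most \<open>l\<close> elements, so by independence its probability does not depend on the
  parity. In the odd case every outcome belongs to the event of some word of each length, hence to
  infinitely many events. In the even case some \<open>S\<^sub>s\<close> is almost surely empty; then only words
  of length at most \<open>s\<close> over the alphabet \<open>{0..m}\<close> remain, and there are finitely many of these.

  The independent copies are realised on \<open>[0, c)\<close> by the digits of \<open>x / c\<close> in base \<open>D\<close>, the common
  number of even and of odd subsets, so that the whole space has measure \<open>c\<close>; the words
  are enumerated by \<open>list_decode\<close>.
\<close>

section \<open>Independence of digits\<close>

definition digit :: "nat \<Rightarrow> real \<Rightarrow> nat \<Rightarrow> real \<Rightarrow> nat" where
  "digit D c s x = nat \<lfloor>x / c * real D ^ Suc s\<rfloor> mod D"

lemma nat_floor_grid_eq_iff: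
  assumes "0 < c" "0 < N"
  shows "0 \<le> x \<and> nat \<lfloor>x / c * real N\<rfloor> = j \<longleftrightarrow>
         x \<in> {c * real j / real N ..< c * real (Suc j) / real N}"
proof -
  have "0 \<le> x \<and> nat \<lfloor>x / c * real N\<rfloor> = j \<longleftrightarrow> \<lfloor>x / c * real N\<rfloor> = int j"
  proof -
    have "0 \<le> x \<longleftrightarrow> 0 \<le> \<lfloor>x / c * real N\<rfloor>"
      using assms by (simp add: zero_le_mult_iff zero_le_divide_iff)
    then show ?thesis by linarith
  qed
  also have "\<dots> \<longleftrightarrow> real j \<le> x / c * real N \<and> x / c * real N < real j + 1"
    by (simp add: floor_eq_iff)
  also have "\<dots> \<longleftrightarrow> x \<in> {c * real j / real N ..< c * real (Suc j) / real N}"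
    using assms by (auto simp: field_simps)
  finally show ?thesis .
qed

lemma emeasure_grid_cells:
  assumes c: "0 < c" and N: "0 < N" and J: "J \<subseteq> {..<N}"
  shows "{x \<in> {0..<c}. nat \<lfloor>x / c * real N\<rfloor> \<in> J} \<in> sets borel"
    and "emeasure lborel {x \<in> {0..<c}. nat \<lfloor>x / c * real N\<rfloor> \<in> J} = ennreal (c * (real (card J) / real N))"
proof -
  define cell where "cell j = {c * real j / real N ..< c * real (Suc j) / real N}" for j
  have fin: "finite J" using J finite_subset by blast
  have cell_iff: "x \<in> cell j \<longleftrightarrow> 0 \<le> x \<and> nat \<lfloor>x / c * real N\<rfloor> = j" for x j
    unfolding cell_def by (rule nat_floor_grid_eq_iff[OF c N, symmetric])
  have "x < c" if "x \<in> cell j" "j \<in> J" for x j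
  proof -
    have "real (Suc j) \<le> real N" using that J by (auto simp: subset_eq Suc_le_eq)
    then have "c * real (Suc j) / real N \<le> c"
      using mult_left_mono[of "real (Suc j)" "real N" c] c N by (simp add: divide_le_eq)
    with that show ?thesis unfolding cell_def by auto
  qed
  then have eq: "{x \<in> {0..<c}. nat \<lfloor>x / c * real N\<rfloor> \<in> J} = (\<Union>j\<in>J. cell j)"
    using cell_iff by auto
  have sets: "cell j \<in> sets lborel" for j unfolding cell_def by simp
  then show "{x \<in> {0..<c}. nat \<lfloor>x / c * real N\<rfloor> \<in> J} \<in> sets borel"
    unfolding eq using fin by auto
  have "emeasure lborel (cell j) = ennreal (c / real N)" for j
    unfolding cell_def using c N by (simp add: field_simps flip: diff_divide_distrib)
  moreover have "disjoint_family_on cell J"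
    unfolding disjoint_family_on_def using cell_iff by auto
  ultimately have "emeasure lborel (\<Union>j\<in>J. cell j) = (\<Sum>j\<in>J. ennreal (c / real N))"
    using sum_emeasure[of cell J lborel] sets fin by (simp add: image_subset_iff)
  also have "\<dots> = ennreal (c * (real (card J) / real N))"
    using c by (simp add: ennreal_of_nat_eq_real_of_nat flip: ennreal_mult)
  finally show "emeasure lborel {x \<in> {0..<c}. nat \<lfloor>x / c * real N\<rfloor> \<in> J} = ennreal (c * (real (card J) / real N))"
    unfolding eq .
qed

lemma nat_floor_grid_div:
  assumes "0 < D"
  shows "nat \<lfloor>y * real D ^ Suc K\<rfloor> div D = nat \<lfloor>y * real D ^ K\<rfloor>"
proof -
  have "y * real D ^ K = (y * real D ^ Suc K) / real_of_int (int D)"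
    using assms by simp
  then have "\<lfloor>y * real D ^ K\<rfloor> = \<lfloor>y * real D ^ Suc K\<rfloor> div int D"
    by (metis floor_divide_real_eq_div of_nat_0_le_iff)
  then show ?thesis by (simp add: nat_div_distrib')
qed

text \<open>
  Prescribing the first \<open>K\<close> digits selects cells of the grid of mesh \<open>c / D ^ K\<close>. A cell of the
  next finer grid is a pair of a cell and a new digit, so the numbers of choices multiply.
\<close>

lemma digit_constraints_grid:
  assumes c: "0 < c" and D: "0 < D"
  shows "\<exists>J \<subseteq> {..<D ^ K}. card J = (\<Prod>s<K. card (T s \<inter> {..<D})) \<and>
    {x \<in> {0..<c}. \<forall>s<K. digit D c s x \<in> T s} = {x \<in> {0..<c}. nat \<lfloor>x / c * real (D ^ K)\<rfloor> \<in> J}"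
proof (induction K)
  case 0
  have "nat \<lfloor>x / c\<rfloor> = 0" if "x \<in> {0..<c}" for x
    using that c by (simp add: floor_eq_iff)
  then show ?case by (intro exI[of _ "{0}"]) auto
next
  case (Suc K)
  then obtain J where J: "J \<subseteq> {..<D ^ K}" "card J = (\<Prod>s<K. card (T s \<inter> {..<D}))"
    and eq: "{x \<in> {0..<c}. \<forall>s<K. digit D c s x \<in> T s} = {x \<in> {0..<c}. nat \<lfloor>x / c * real (D ^ K)\<rfloor> \<in> J}"
    by blast
  define J' where "J' = {j. j div D \<in> J \<and> j mod D \<in> T K}"
  have "bij_betw (\<lambda>(j, t). j * D + t) (J \<times> (T K \<inter> {..<D})) J'"
    by (rule bij_betw_byWitness[where f' = "\<lambda>j. (j div D, j mod D)"])
      (use D in \<open>auto simp: J'_def div_mult_self3\<close>)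
  then have "card J' = card (J \<times> (T K \<inter> {..<D}))"
    by (simp add: bij_betw_same_card)
  then have "card J' = (\<Prod>s<Suc K. card (T s \<inter> {..<D}))"
    using J(2) by (simp add: card_cartesian_product)
  moreover have "J' \<subseteq> {..<D ^ Suc K}"
    using J(1) D by (auto simp: J'_def subset_eq div_less_iff_less_mult mult.commute)
  moreover have "{x \<in> {0..<c}. \<forall>s<Suc K. digit D c s x \<in> T s} =
      {x \<in> {0..<c}. nat \<lfloor>x / c * real (D ^ Suc K)\<rfloor> \<in> J'}"
  proof -
    have "{x \<in> {0..<c}. \<forall>s<Suc K. digit D c s x \<in> T s} =
        {x \<in> {0..<c}. nat \<lfloor>x / c * real (D ^ K)\<rfloor> \<in> J \<and> digit D c K x \<in> T K}"
      using eq by (auto simp: less_Suc_eq)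
    also have "\<dots> = {x \<in> {0..<c}. nat \<lfloor>x / c * real (D ^ Suc K)\<rfloor> \<in> J'}"
      unfolding J'_def digit_def of_nat_power mem_Collect_eq nat_floor_grid_div[OF D] ..
    finally show ?thesis .
  qed
  ultimately show ?case by blast
qed

lemma
  assumes c: "0 \<le> c" and D: "0 < D"
  shows sets_digit_constraints: "{x \<in> {0..<c}. \<forall>s<K. digit D c s x \<in> T s} \<in> sets borel"
    and emeasure_digit_constraints:
      "emeasure lborel {x \<in> {0..<c}. \<forall>s<K. digit D c s x \<in> T s} =
        ennreal (c * (\<Prod>s<K. real (card (T s \<inter> {..<D})) / real D))"
proof -
  let ?X = "{x \<in> {0..<c}. \<forall>s<K. digit D c s x \<in> T s}"
  have "?X \<in> sets borel \<and>
    emeasure lborel ?X = ennreal (c * (\<Prod>s<K. real (card (T s \<inter> {..<D})) / real D))"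
  proof (cases "c = 0")
    case False
    then have c': "0 < c" using c by simp
    obtain J where J: "J \<subseteq> {..<D ^ K}" "card J = (\<Prod>s<K. card (T s \<inter> {..<D}))"
      and eq: "?X = {x \<in> {0..<c}. nat \<lfloor>x / c * real (D ^ K)\<rfloor> \<in> J}"
      using digit_constraints_grid[OF c' D, of K T] by blast
    have "0 < D ^ K" using D by simp
    from emeasure_grid_cells[OF c' this J(1)] show ?thesis
      unfolding eq by (simp add: J(2) prod_dividef)
  qed simp
  then show "?X \<in> sets borel"
    and "emeasure lborel ?X = ennreal (c * (\<Prod>s<K. real (card (T s \<inter> {..<D})) / real D))"
    by blast+
qed

section \<open>Even and odd subsets\<close>

definition parity_subsets :: "nat \<Rightarrow> bool \<Rightarrow> nat set set" where
  "parity_subsets m p = {S. S \<subseteq> {..m} \<and> even (card S) = p}"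

lemma finite_parity_subsets: "finite (parity_subsets m p)"
  by (rule finite_subset[of _ "Pow {..m}"]) (auto simp: parity_subsets_def)

text \<open>
  Toggling an element \<open>a\<close> outside \<open>I\<close> is an involution exchanging the two families.
\<close>

lemma card_supersets_parity:
  assumes "a \<le> m" "a \<notin> I"
  shows "card {S \<in> parity_subsets m True. I \<subseteq> S} = card {S \<in> parity_subsets m False. I \<subseteq> S}"
proof -
  define tog where "tog S = (if a \<in> S then S - {a} else insert a S)" for S :: "nat set"
  have tog: "tog S \<in> parity_subsets m (\<not> p) \<and> I \<subseteq> tog S"
    if "S \<in> parity_subsets m p" "I \<subseteq> S" for S p
  proof -
    have "finite S" using that finite_subset by (auto simp: parity_subsets_def)
    then have "even (card (tog S)) \<longleftrightarrow> odd (card S)"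
      using card_Suc_Diff1[of S a] by (cases "a \<in> S") (auto simp: tog_def simp flip: even_Suc)
    then show ?thesis using that assms by (auto simp: parity_subsets_def tog_def)
  qed
  have "tog (tog S) = S" for S by (auto simp: tog_def)
  then have "bij_betw tog {S \<in> parity_subsets m True. I \<subseteq> S} {S \<in> parity_subsets m False. I \<subseteq> S}"
    using tog[where p = True] tog[where p = False]
    by (intro bij_betw_byWitness[where f' = tog]) (simp_all add: image_subset_iff)
  then show ?thesis by (rule bij_betw_same_card)
qed

text \<open>
  There are as many even as odd subsets, so the two sequences can be read off from the same base
  \<open>D\<close> digits of a point, once with digits standing for even and once for odd subsets.
\<close>

lemma parity_subsets_enumeration:
  obtains D :: nat and f :: "bool \<Rightarrow> nat \<Rightarrow> nat set"
  where "0 < D" "\<And>p. bij_betw (f p) {..<D} (parity_subsets m p)"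
proof -
  define D where "D = card (parity_subsets m True)"
  have "{} \<in> parity_subsets m True" by (simp add: parity_subsets_def)
  then have "0 < D" unfolding D_def using finite_parity_subsets card_gt_0_iff by blast
  moreover have "D = card (parity_subsets m p)" for p
    using card_supersets_parity[of 0 m "{}"] by (cases p) (simp_all add: D_def)
  then have "\<exists>g. bij_betw g {..<D} (parity_subsets m p)" for p
    using ex_bij_betw_nat_finite[OF finite_parity_subsets, of m p] by (auto simp: atLeast0LessThan)
  then obtain f where "\<And>p. bij_betw (f p) {..<D} (parity_subsets m p)" by metis
  ultimately show ?thesis using that by blast
qed

lemma card_digits_of_supersets:
  assumes "bij_betw g {..<D} (parity_subsets m p)"
  shows "card ({j. I \<subseteq> g j} \<inter> {..<D}) = card {S \<in> parity_subsets m p. I \<subseteq> S}"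
proof -
  have "{j. I \<subseteq> g j} \<inter> {..<D} = {j \<in> {..<D}. I \<subseteq> g j}" by auto
  also have "card \<dots> = card {S \<in> parity_subsets m p. I \<subseteq> S}"
    by (rule bij_betw_same_card[OF bij_betw_Collect[OF assms]]) simp
  finally show ?thesis .
qed

section \<open>Sets attached to words\<close>

definition word_set :: "nat \<Rightarrow> real \<Rightarrow> (nat \<Rightarrow> nat set) \<Rightarrow> nat list \<Rightarrow> real set" where
  "word_set D c g w = {x \<in> {0..<c}. \<forall>s<length w. w ! s \<in> g (digit D c s x)}"

lemma sets_word_set:
  assumes "0 \<le> c" "0 < D"
  shows "word_set D c g w \<in> sets borel"
  using sets_digit_constraints[OF assms, of "length w" "\<lambda>s. {j. w ! s \<in> g j}"]
  unfolding word_set_def mem_Collect_eq .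

text \<open>
  At each position, the words in \<open>W\<close> require at most \<open>m\<close> letters, so some letter of the alphabet
  \<open>{..m}\<close> is left free to be toggled.
\<close>

lemma emeasure_Inter_word_sets_parity:
  assumes c: "0 \<le> c" and D: "0 < D"
    and f: "\<And>p. bij_betw (f p) {..<D} (parity_subsets m p)"
    and W: "finite W" "W \<noteq> {}" "card W \<le> m"
  shows "emeasure lborel (\<Inter>w\<in>W. word_set D c (f True) w) =
         emeasure lborel (\<Inter>w\<in>W. word_set D c (f False) w)"
proof -
  define K where "K = Max (length ` W)"
  \<comment> \<open>the letters required at position \<open>s\<close>\<close>
  define I where "I s = (\<lambda>w. w ! s) ` {w \<in> W. s < length w}" for s
  have len: "length w \<le> K" if "w \<in> W" for w
    unfolding K_def using that W(1) by simp
  have eq: "(\<Inter>w\<in>W. word_set D c g w) =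
      {x \<in> {0..<c}. \<forall>s<K. digit D c s x \<in> {j. I s \<subseteq> g j}}" for g
  proof (rule set_eqI)
    fix x
    have "x \<in> (\<Inter>w\<in>W. word_set D c g w) \<longleftrightarrow>
        x \<in> {0..<c} \<and> (\<forall>w\<in>W. \<forall>s<length w. w ! s \<in> g (digit D c s x))"
      using W(2) by (auto simp: word_set_def)
    also have "(\<forall>w\<in>W. \<forall>s<length w. w ! s \<in> g (digit D c s x)) \<longleftrightarrow>
        (\<forall>s<K. \<forall>w\<in>W. s < length w \<longrightarrow> w ! s \<in> g (digit D c s x))"
      using len by (meson less_le_trans)
    also have "\<dots> \<longleftrightarrow> (\<forall>s<K. I s \<subseteq> g (digit D c s x))"
      by (auto simp: I_def)
    finally show "x \<in> (\<Inter>w\<in>W. word_set D c g w) \<longleftrightarrow>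
        x \<in> {x \<in> {0..<c}. \<forall>s<K. digit D c s x \<in> {j. I s \<subseteq> g j}}" by simp
  qed
  have "card ({j. I s \<subseteq> f True j} \<inter> {..<D}) = card ({j. I s \<subseteq> f False j} \<inter> {..<D})" for s
  proof -
    have "card (I s) \<le> card {w \<in> W. s < length w}"
      unfolding I_def using W(1) by (intro card_image_le) auto
    also have "\<dots> \<le> card W" using W(1) by (intro card_mono) auto
    finally have "card (I s) < card {..m}" using W(3) by simp
    moreover have "finite (I s)" unfolding I_def using W(1) by simp
    ultimately have "\<not> {..m} \<subseteq> I s" using card_mono leD by blast
    then obtain a where "a \<le> m" "a \<notin> I s" by auto
    from card_supersets_parity[OF this] show ?thesis
      by (simp only: card_digits_of_supersets[OF f])
  qed
  then show ?thesis
    unfolding eq emeasure_digit_constraints[OF c D] by simp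
qed

section \<open>Upper limits\<close>

lemma mem_limsup_iff:
  fixes A :: "nat \<Rightarrow> 'a set"
  shows "x \<in> limsup A \<longleftrightarrow> infinite {i. x \<in> A i}"
  unfolding limsup_INF_SUP by (auto simp: infinite_nat_iff_unbounded_le)

lemma mem_limsup_list_decode_iff:
  "x \<in> limsup (\<lambda>i. F (list_decode i)) \<longleftrightarrow> infinite {w. x \<in> F w}"
proof -
  have "bij_betw list_decode {i. x \<in> F (list_decode i)} {w. x \<in> F w}"
    using bij_betw_Collect[OF bij_list_decode, of "\<lambda>w. x \<in> F w" "\<lambda>i. x \<in> F (list_decode i)"] by simp
  then show ?thesis unfolding mem_limsup_iff by (simp add: bij_betw_finite)
qed

text \<open>
  A set of odd size is nonempty, so every point admits a choice \<open>h\<close> of one letter per position,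
  and it lies in the sets of all prefixes of \<open>h\<close>.
\<close>

lemma limsup_word_set_odd:
  assumes D: "0 < D" and g: "bij_betw g {..<D} (parity_subsets m False)"
  shows "limsup (\<lambda>i. word_set D c g (list_decode i)) = {0..<c}"
proof -
  have ne: "g (digit D c s x) \<noteq> {}" for s x
  proof -
    have "digit D c s x < D" using D by (simp add: digit_def)
    then have "g (digit D c s x) \<in> parity_subsets m False"
      using g by (auto simp: bij_betw_def)
    then show ?thesis by (auto simp: parity_subsets_def)
  qed
  have "infinite {w. x \<in> word_set D c g w}" if x: "x \<in> {0..<c}" for x
  proof
    assume fin: "finite {w. x \<in> word_set D c g w}"
    have "\<forall>s. \<exists>i. i \<in> g (digit D c s x)" using ne by blast
    then obtain h where h: "\<And>s. h s \<in> g (digit D c s x)" by metis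
    have "range (\<lambda>n. map h [0..<n]) \<subseteq> {w. x \<in> word_set D c g w}"
      using h x by (auto simp: word_set_def)
    moreover have "inj (\<lambda>n. map h [0..<n])"
      by (rule inj_on_inverseI[where g = length]) simp
    ultimately show False
      using fin finite_imageD finite_subset infinite_UNIV_nat by blast
  qed
  moreover have "x \<in> {0..<c}" if "infinite {w. x \<in> word_set D c g w}" for x
    using not_finite_existsD[OF that] by (auto simp: word_set_def)
  ultimately show ?thesis
    unfolding set_eq_iff mem_limsup_list_decode_iff by blast
qed

text \<open>
  If a digit at position \<open>s\<close> stands for the empty set, the point lies in the sets
  of words over \<open>{..m}\<close> of length at most \<open>s\<close> only, and there are finitely many of these. So in the upper limit
  the digit of \<open>{}\<close> is excluded at every position, and the measure left after \<open>K\<close> positions decays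
  geometrically.
\<close>

lemma emeasure_limsup_word_set_even:
  assumes c: "0 \<le> c" and D: "0 < D" and g: "bij_betw g {..<D} (parity_subsets m True)"
  shows "emeasure lborel (limsup (\<lambda>i. word_set D c g (list_decode i))) = 0"
proof -
  let ?L = "limsup (\<lambda>i. word_set D c g (list_decode i))"
  have sub: "?L \<subseteq> {x \<in> {0..<c}. \<forall>s<K. digit D c s x \<in> {j. g j \<noteq> {}}}" for K
  proof
    fix x assume "x \<in> ?L"
    then have inf: "infinite {w. x \<in> word_set D c g w}" by (simp add: mem_limsup_list_decode_iff)
    have alphabet: "g (digit D c s x) \<subseteq> {..m}" for s
      using g D by (auto simp: bij_betw_def parity_subsets_def digit_def)
    have "g (digit D c s x) \<noteq> {}" for s
    proof
      assume empty: "g (digit D c s x) = {}"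
      have "{w. x \<in> word_set D c g w} \<subseteq> {w. set w \<subseteq> {..m} \<and> length w \<le> s}"
      proof (rule subsetI, simp, rule conjI)
        fix w assume w: "x \<in> word_set D c g w"
        show "set w \<subseteq> {..m}"
          using w alphabet unfolding word_set_def by (fastforce simp: in_set_conv_nth)
        show "length w \<le> s"
          using w empty unfolding word_set_def by (metis (mono_tags, lifting) empty_iff mem_Collect_eq not_le)
      qed
      then show False using inf finite_lists_length_le[of "{..m}" s] finite_subset by blast
    qed
    moreover have "x \<in> {0..<c}"
      using not_finite_existsD[OF inf] by (auto simp: word_set_def)
    ultimately show "x \<in> {x \<in> {0..<c}. \<forall>s<K. digit D c s x \<in> {j. g j \<noteq> {}}}" by simp
  qed
  define q where "q = real (card ({j. g j \<noteq> {}} \<inter> {..<D})) / real D"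
  have "{} \<in> g ` {..<D}" using g by (auto simp: bij_betw_def parity_subsets_def)
  then have "{j. g j \<noteq> {}} \<inter> {..<D} \<subset> {..<D}" by auto
  then have "card ({j. g j \<noteq> {}} \<inter> {..<D}) < D"
    using psubset_card_mono[of "{..<D}"] by simp
  then have q: "0 \<le> q" "q < 1" unfolding q_def using D by auto
  have bound: "emeasure lborel ?L \<le> ennreal (c * q ^ K)" for K
  proof -
    have "emeasure lborel ?L \<le> emeasure lborel {x \<in> {0..<c}. \<forall>s<K. digit D c s x \<in> {j. g j \<noteq> {}}}"
      by (rule emeasure_mono[OF sub]) (simp only: sets_lborel sets_digit_constraints[OF c D])
    also have "\<dots> = ennreal (c * q ^ K)"
      unfolding emeasure_digit_constraints[OF c D] by (simp add: q_def)
    finally show ?thesis .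
  qed
  have "(\<lambda>K. c * q ^ K) \<longlonglongrightarrow> c * 0"
    using q by (intro tendsto_mult_left LIMSEQ_realpow_zero)
  then have "(\<lambda>K. ennreal (c * q ^ K)) \<longlonglongrightarrow> ennreal 0"
    by (intro tendsto_ennrealI) simp
  then have "emeasure lborel ?L \<le> ennreal 0"
    by (rule LIMSEQ_le_const) (use bound in blast)
  then show ?thesis by simp
qed

section \<open>The two sequences\<close>

theorem theorem1p1:
  fixes m :: nat and c :: real
  assumes "1 \<le> m" and "0 \<le> c" and "c \<le> 1"
  shows "\<exists>(A :: nat \<Rightarrow> real set) (B :: nat \<Rightarrow> real set).
    (\<forall>i\<ge>1. A i \<in> sets borel \<and> A i \<subseteq> {0..1} \<and> B i \<in> sets borel \<and> B i \<subseteq> {0..1}) \<and>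
    (\<forall>i\<ge>1. emeasure lborel (A i) = emeasure lborel (B i)) \<and>
    (\<forall>(l::nat) (s :: nat \<Rightarrow> nat). 1 \<le> l \<and> l \<le> m \<and> (\<forall>k\<in>{1..l}. 1 \<le> s k) \<longrightarrow>
       emeasure lborel (\<Inter>k\<in>{1..l}. A (s k)) = emeasure lborel (\<Inter>k\<in>{1..l}. B (s k))) \<and>
    emeasure lborel (limsup A) = 0 \<and>
    emeasure lborel (limsup B) = ennreal c"
proof -
  obtain D and f :: "bool \<Rightarrow> nat \<Rightarrow> nat set" where D: "0 < D"
    and f: "\<And>p. bij_betw (f p) {..<D} (parity_subsets m p)"
    using parity_subsets_enumeration by blast
  define X where "X p i = word_set D c (f p) (list_decode i)" for p i
  have X_borel: "X p i \<in> sets borel" for p i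
    unfolding X_def by (rule sets_word_set[OF assms(2) D])
  have X_subset: "X p i \<subseteq> {0..1}" for p i
    unfolding X_def word_set_def using assms(3) by auto
  have Inter: "emeasure lborel (\<Inter>k\<in>{1..l}. X True (s k)) = emeasure lborel (\<Inter>k\<in>{1..l}. X False (s k))"
    if l: "1 \<le> l" "l \<le> m" for l and s :: "nat \<Rightarrow> nat"
  proof -
    define W where "W = (\<lambda>k. list_decode (s k)) ` {1..l}"
    have "card W \<le> m" unfolding W_def using card_image_le[of "{1..l}"] l(2) by (auto intro: order_trans)
    moreover have "finite W" "W \<noteq> {}" unfolding W_def using l by auto
    ultimately have "emeasure lborel (\<Inter>w\<in>W. word_set D c (f True) w) =
        emeasure lborel (\<Inter>w\<in>W. word_set D c (f False) w)"
      by (intro emeasure_Inter_word_sets_parity[OF assms(2) D f])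
    then show ?thesis by (simp add: W_def X_def image_image)
  qed
  have single: "emeasure lborel (X True i) = emeasure lborel (X False i)" for i
    using Inter[of 1 "\<lambda>_. i"] assms(1) by simp
  have "emeasure lborel (limsup (X True)) = 0"
    using emeasure_limsup_word_set_even[OF assms(2) D f] by (simp add: X_def[abs_def])
  moreover have "emeasure lborel (limsup (X False)) = ennreal c"
    using limsup_word_set_odd[OF D f, of c] assms(2) by (simp add: X_def[abs_def])
  ultimately show ?thesis
    using X_borel X_subset Inter single by (intro exI[of _ "X True"] exI[of _ "X False"]) blast
qed

end
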